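(* Let $(\theta,\varphi)$ be a continuous time random dynamical system (RDS) over a probability space $(\Omega,\mathcal F,\mathbb P)$ on a nonempty finite state space $X$ (equipped with the discrete topology). For $t\ge 0$ and $t_0\in\mathbb R$ let $$\Gamma(t,t_0):=\{\omega\in\Omega : \varphi(t,x_1,\theta_{t_0}\omega)=\varphi(t,x_2,\theta_{t_0}\omega)\text{ for all }x_1,x_2\in X\},$$ and let $A(\omega):=\bigcap_{t\ge 0}\varphi(t,X,\theta_{-t}\omega)$. Consider the following statements: (1) There exists $t>0$ such that $\mathbb P(\Gamma(t,0))>0$. (2) For any $t_0\in\mathbb R$ it holds that $\lim_{t\to\infty}\mathbb P(\Gamma(t,t_0))=1$ and $\lim_{t\to\infty}\mathbb P(\Gamma(t,t_0-t))=1$, and the rate of convergence is independent of $t_0$. (3) For any $t_0\in\mathbb R$, $\mathbb P(\{\omega\in\Omega : \varphi(t,X,\theta_{t_0}\omega)\text{ is a singleton for some }t\ge 0\})=1$. (4) For any $t_0\in\mathbb R$, $\mathbb P(\{\omega\in\Omega : \varphi(t,X,\theta_{t_0-t}\omega)\text{ is a singleton for some }t\ge 0\})=1$. (5) The sets $A(\omega)$ are singletons for almost all $\omega\in\Omega$. Then statements (2), (3), (4), (5) are all equivalent to each other, and they imply statement (1). If in addition the solutions $\varphi(t,x,\cdot)$ are stochastically independent on non-overlapping intervals, i.e., $\varphi(t,x,\cdot)$ for $t\in[t_1,t_2)$ is independent of $\varphi(s,x,\cdot)$ for $s\in[s_1,s_2)$ if $[t_1,t_2)\cap[s_1,s_2)=\emptyset$,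 then statement (1) is equivalent to statements (2)-(5), and the convergence in statement (2) has an exponential rate.
   Context: RDS: A continuous time random dynamical system $(\theta,\varphi)$ on a topological space $X$ (with its Borel $\sigma$-algebra) consists of (I) a family $\theta=\{\theta_t\}_{t\in\mathbb R}$ of maps on a probability space $(\Omega,\mathcal F,\mathbb P)$ with $\theta_0(\omega)=\omega$, $\theta_{s+t}(\omega)=\theta_s\circ\theta_t(\omega)$ for all $\omega\in\Omega$ and $s,t\in\mathbb R$, $(t,\omega)\mapsto\theta_t(\omega)$ measurable, and $\mathbb P(\theta_tB)=\mathbb P(B)$ for all $B\in\mathcal F$, $t\in\mathbb R$; (II) a map $\varphi:\mathbb R_0^+\times X\times\Omega\to X$ (where $\mathbb R_0^+=[0,\infty)$) such that $\varphi(0,x,\omega)=x$ for all $x,\omega$; $\varphi(s+t,x,\omega)=\varphi(s,\varphi(t,x,\omega),\theta_t\omega)$ for all $s,t\ge 0$, $x\in X$, $\omega\in\Omega$; $(t,x,\omega)\mapsto\varphi(t,x,\omega)$ is measurable; and $x\mapsto\varphi(t,x,\omega)$ is continuous for all $(t,\omega)$. For $B\subseteq X$ write $\varphi(t,B,\omega)=\{\varphi(t,x,\omega): x\in B\}$. Here $\varphi(t,x,\theta_{t_0}\omega)$ is the state at absolute time $t_0+t$ of the solution started at time $t_0$ in $x$. Exponential rate in (2) means: there are constants $C,c>0$ such that $1-\mathbb P(\Gamma(t,t_0))\le Ce^{-ct}$ and $1-\mathbb P(\Gamma(t,t_0-t))\le Ce^{-ct}$ for all $t\ge 0$ and all $t_0\in\mathbb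 R$. "Rate of convergence independent of $t_0$" means that the convergence is uniform in $t_0\in\mathbb R$. *)

theory Defs
  imports "HOL-Probability.Probability"
begin

locale continuous_rds = prob_space M
  for M :: "'w measure" +
  fixes \<theta> :: "real \<Rightarrow> 'w \<Rightarrow> 'w"
    and \<phi> :: "real \<Rightarrow> 'x::topological_space \<Rightarrow> 'w \<Rightarrow> 'x"
  assumes flow_zero: "\<And>\<omega>. \<omega> \<in> space M \<Longrightarrow> \<theta> 0 \<omega> = \<omega>"
    and flow_add: "\<And>s t \<omega>. \<omega> \<in> space M \<Longrightarrow> \<theta> (s + t) \<omega> = \<theta> s (\<theta> t \<omega>)"
    and flow_measurable: "(\<lambda>(t, \<omega>). \<theta> t \<omega>) \<in> borel \<Otimes>\<^sub>M M \<rightarrow>\<^sub>M M"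
    and flow_preserving: "\<And>t B. B \<in> sets M \<Longrightarrow> measure M (\<theta> t ` B) = measure M B"
    and cocycle_zero: "\<And>x \<omega>. \<omega> \<in> space M \<Longrightarrow> \<phi> 0 x \<omega> = x"
    and cocycle_add: "\<And>s t x \<omega>. 0 \<le> s \<Longrightarrow> 0 \<le> t \<Longrightarrow> \<omega> \<in> space M \<Longrightarrow>
          \<phi> (s + t) x \<omega> = \<phi> s (\<phi> t x \<omega>) (\<theta> t \<omega>)"
    and cocycle_measurable: "(\<lambda>(t, x, \<omega>). \<phi> t x \<omega>) \<in>
          restrict_space borel {0..} \<Otimes>\<^sub>M (borel \<Otimes>\<^sub>M M) \<rightarrow>\<^sub>M borel"
    and cocycle_continuous: "\<And>t \<omega>. 0 \<le> t \<Longrightarrow> \<omega> \<in> space M \<Longrightarrow>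
          continuous_on UNIV (\<lambda>x. \<phi> t x \<omega>)"

definition cocycle_image ::
    "(real \<Rightarrow> 'x \<Rightarrow> 'w \<Rightarrow> 'x) \<Rightarrow> real \<Rightarrow> 'x set \<Rightarrow> 'w \<Rightarrow> 'x set" where
  "cocycle_image \<phi> t B \<omega> = (\<lambda>x. \<phi> t x \<omega>) ` B"

definition coalescence_event ::
    "'w measure \<Rightarrow> (real \<Rightarrow> 'w \<Rightarrow> 'w) \<Rightarrow> (real \<Rightarrow> 'x \<Rightarrow> 'w \<Rightarrow> 'x)
      \<Rightarrow> real \<Rightarrow> real \<Rightarrow> 'w set" where
  "coalescence_event M \<theta> \<phi> t t\<^sub>0 =
     {\<omega> \<in> space M. \<forall>x\<^sub>1 x\<^sub>2. \<phi> t x\<^sub>1 (\<theta> t\<^sub>0 \<omega>) = \<phi> t x\<^sub>2 (\<theta> t\<^sub>0 \<omega>)}"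

definition pullback_attractor ::
    "(real \<Rightarrow> 'w \<Rightarrow> 'w) \<Rightarrow> (real \<Rightarrow> 'x \<Rightarrow> 'w \<Rightarrow> 'x) \<Rightarrow> 'w \<Rightarrow> 'x set" where
  "pullback_attractor \<theta> \<phi> \<omega> = (\<Inter>t\<in>{0..}. cocycle_image \<phi> t UNIV (\<theta> (- t) \<omega>))"

text \<open>
  All solutions started at time \<open>a\<close>, observed on the time interval \<open>[a, b)\<close>. The first
  component of the index is absolute time: the solution started at time \<open>a\<close> in \<open>x\<close> has
  state \<open>\<phi> (t - a) x (\<theta> a \<omega>)\<close> at time \<open>t\<close>.
\<close>
definition solutions_on ::
    "(real \<Rightarrow> 'w \<Rightarrow> 'w) \<Rightarrow> (real \<Rightarrow> 'x \<Rightarrow> 'w \<Rightarrow> 'x) \<Rightarrow> real \<Rightarrow> real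
      \<Rightarrow> 'w \<Rightarrow> real \<times> 'x \<Rightarrow> 'x" where
  "solutions_on \<theta> \<phi> a b \<omega> = (\<lambda>(t, x) \<in> {a..<b} \<times> UNIV. \<phi> (t - a) x (\<theta> a \<omega>))"

text \<open>
  Independence is required jointly in the initial state. Independence for each \<open>x\<close>
  separately would not control events such as \<open>\<phi> t x\<^sub>1 = \<phi> t x\<^sub>2\<close>. The times
  may be negative, as the flow \<open>\<theta>\<close> is two-sided.
\<close>
definition indep_on_disjoint_intervals ::
    "'w measure \<Rightarrow> (real \<Rightarrow> 'w \<Rightarrow> 'w) \<Rightarrow>
      (real \<Rightarrow> 'x::topological_space \<Rightarrow> 'w \<Rightarrow> 'x) \<Rightarrow> bool" where
  "indep_on_disjoint_intervals M \<theta> \<phi> \<longleftrightarrow>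
     (\<forall>t\<^sub>1 t\<^sub>2 s\<^sub>1 s\<^sub>2. {t\<^sub>1..<t\<^sub>2} \<inter> {s\<^sub>1..<s\<^sub>2} = {} \<longrightarrow>
        prob_space.indep_var M
          (Pi\<^sub>M ({t\<^sub>1..<t\<^sub>2} \<times> UNIV) (\<lambda>_. borel)) (solutions_on \<theta> \<phi> t\<^sub>1 t\<^sub>2)
          (Pi\<^sub>M ({s\<^sub>1..<s\<^sub>2} \<times> UNIV) (\<lambda>_. borel)) (solutions_on \<theta> \<phi> s\<^sub>1 s\<^sub>2))"

end

theory Submission
  imports Defs "HOL-Real_Asymp.Real_Asymp"
begin

text \<open>
  Invariance of the measure makes the probability \<open>p t\<close> of \<open>\<Gamma>(t, t\<^sub>0)\<close> independent of \<open>t\<^sub>0\<close>, and the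
  cocycle property makes both \<open>\<Gamma>(t, t\<^sub>0)\<close> and \<open>\<Gamma>(t, t\<^sub>0 - t)\<close> increase with \<open>t\<close>. Hence the events in
  (3), (4) and (5) are increasing unions over natural times (for (5) because a decreasing family of
  nonempty finite sets stabilises), and (2)--(5) all say that \<open>p t\<close> tends to \<open>1\<close>. Under
  independence, two trajectories that are apart at time \<open>u + t\<close> are apart at time \<open>s < u\<close> and also
  fail to coalesce on \<open>[u, u + t]\<close>, so \<open>1 - p\<close> is submultiplicative up to an arbitrarily small loss of
  time, and it decays exponentially as soon as it is below \<open>1\<close> somewhere.
\<close>

section \<open>Preliminaries on decay, limits and finite sets\<close>

text \<open>Rounding \<open>t\<close> down to a multiple of \<open>h\<close> costs at most one
  factor \<open>1 / r'\<close>, which becomes \<open>C\<close>; the rate is minus the logarithm of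
  the ratio, divided by the step length.\<close>

lemma exp_bound_of_power_bound:
  fixes q :: "real \<Rightarrow> real"
  assumes "0 < h" "0 \<le> r" "r < 1"
    and antimono: "\<And>s t. 0 \<le> s \<Longrightarrow> s \<le> t \<Longrightarrow> q t \<le> q s"
    and power: "\<And>n. q (real n * h) \<le> r ^ n"
  shows "\<exists>C>0. \<exists>c>0. \<forall>t\<ge>0. q t \<le> C * exp (- c * t)"
proof -
  \<comment> \<open>\<open>r = 0\<close> has no logarithm.\<close>
  define r' where "r' = max r (1/2)"
  have r': "0 < r'" "r' < 1" "r \<le> r'"
    using assms by (auto simp: r'_def)
  define c where "c = - ln r' / h"
  have "c > 0"
    using r' \<open>0 < h\<close> by (simp add: c_def field_simps)
  moreover have "q t \<le> (1 / r') * exp (- c * t)" if "t \<ge> 0" for t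
  proof -
    define n where "n = nat \<lfloor>t / h\<rfloor>"
    have n: "real n \<le> t / h" "t / h < real n + 1"
      using that \<open>0 < h\<close> by (auto simp: n_def)
    have "q t \<le> q (real n * h)"
      using n \<open>0 < h\<close> by (intro antimono) (auto simp: field_simps)
    also have "\<dots> \<le> r' ^ n"
      using power[of n] power_mono[of r r' n] r' \<open>0 \<le> r\<close> by linarith
    also have "\<dots> = r' powr real n"
      using r' by (simp add: powr_realpow)
    also have "\<dots> \<le> r' powr (t / h - 1)"
      using n r' by (intro powr_mono') auto
    also have "\<dots> = (1 / r') * exp (- c * t)"
      using r' by (simp add: powr_def c_def right_diff_distrib' left_diff_distrib exp_diff)
    finally show ?thesis .
  qed
  ultimately show ?thesis
    using r' by (intro exI[of _ "1 / r'"] exI[of _ c] conjI) auto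
qed

text \<open>Where \<open>f\<close> does not depend on its parameter, uniformity is free. This is how
  a rate independent of the starting time arises.\<close>

lemma uniform_limit_one_iff:
  fixes f :: "real \<Rightarrow> 'a \<Rightarrow> real"
  assumes "\<And>t a. t \<ge> 0 \<Longrightarrow> f t a = p t"
  shows "uniform_limit UNIV f (\<lambda>_. 1) at_top \<longleftrightarrow> (p \<longlongrightarrow> 1) at_top"
proof -
  have "(\<forall>\<^sub>F t in at_top. \<forall>a\<in>UNIV. dist (f t a) 1 < e) \<longleftrightarrow> (\<forall>\<^sub>F t in at_top. dist (p t) 1 < e)" for e
    using assms by (intro eventually_cong[OF eventually_ge_at_top[of 0]]) auto
  then show ?thesis
    by (simp add: uniform_limit_iff tendsto_iff)
qed

lemma is_singleton_image_UNIV: "is_singleton (range f) \<longleftrightarrow> (\<forall>x y. f x = f y)"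
  by (metis image_subset_iff is_singleton_def rangeI singletonD singletonI UNIV_I image_is_empty
      UNIV_not_empty subset_singletonD)

text \<open>A member of least cardinality lies inside every other member and therefore is the
  intersection. Nonemptiness keeps it from being smaller than a singleton.\<close>

lemma is_singleton_decreasing_INT:
  fixes B :: "real \<Rightarrow> 'a::finite set"
  assumes decreasing: "\<And>s t. 0 \<le> s \<Longrightarrow> s \<le> t \<Longrightarrow> B t \<subseteq> B s" and nonempty: "\<And>t. 0 \<le> t \<Longrightarrow> B t \<noteq> {}"
  shows "is_singleton (\<Inter>t\<in>{0..}. B t) \<longleftrightarrow> (\<exists>t\<ge>0. is_singleton (B t))"
proof -
  define t where "t = arg_min (\<lambda>t. card (B t)) (\<lambda>t. t \<ge> 0)"
  have t: "t \<ge> 0" "\<And>s. s \<ge> 0 \<Longrightarrow> card (B t) \<le> card (B s)"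
    using arg_min_nat_lemma[of "\<lambda>t. t \<ge> 0" 0 "\<lambda>t. card (B t)"] by (auto simp: t_def)
  have least: "B t \<subseteq> B s" if "s \<ge> 0" for s
  proof -
    have "B (max s t) = B t"
      using t that by (intro card_seteq decreasing) auto
    then show ?thesis
      using decreasing[of s "max s t"] that by auto
  qed
  then have "(\<Inter>t\<in>{0..}. B t) = B t"
    using t by auto
  moreover have "is_singleton (B t)" if "s \<ge> 0" "is_singleton (B s)" for s
    using least[of s] nonempty[of t] t that by (auto simp: is_singleton_def subset_singleton_iff)
  ultimately show ?thesis
    using t by auto
qed

lemma sets_borel_discrete [simp]: "sets (borel :: 'a::discrete_topology measure) = UNIV"
  by (auto intro!: borel_open discrete_topology_class.open_discrete)

lemma measurable_borel_discrete:
  "measurable M (borel :: 'a::discrete_topology measure) = measurable M (count_space UNIV)"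
  by (rule measurable_cong_sets) simp_all

section \<open>Invariance and measurability over a finite state space\<close>

text \<open>The sort of \<open>'x\<close> encodes the finite discrete state space; it is nonempty
  because types are inhabited.\<close>

locale finite_rds = continuous_rds M \<theta> \<phi>
  for M :: "'w measure" and \<theta> :: "real \<Rightarrow> 'w \<Rightarrow> 'w"
    and \<phi> :: "real \<Rightarrow> 'x::{finite, discrete_topology} \<Rightarrow> 'w \<Rightarrow> 'x"
begin

abbreviation \<Gamma> where "\<Gamma> \<equiv> coalescence_event M \<theta> \<phi>"

lemma flow_measurable_at [measurable]: "\<theta> t \<in> M \<rightarrow>\<^sub>M M"
  using measurable_Pair2[OF flow_measurable, of t] by simp

lemma flow_in_space: "\<omega> \<in> space M \<Longrightarrow> \<theta> t \<omega> \<in> space M"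
  using measurable_space[OF flow_measurable_at] .

lemma flow_inverse: "\<omega> \<in> space M \<Longrightarrow> \<theta> (- t) (\<theta> t \<omega>) = \<omega>"
  using flow_add[of \<omega> "- t" t] flow_zero by simp

text \<open>Invariance is assumed for images, while events are shifted by preimages; the two agree
  because \<open>\<theta> (- t)\<close> inverts \<open>\<theta> t\<close>.\<close>

lemma prob_flow_vimage:
  assumes "B \<in> sets M"
  shows "prob (\<theta> t -` B \<inter> space M) = prob B"
proof -
  have "\<theta> t -` B \<inter> space M = \<theta> (- t) ` B"
  proof (intro set_eqI iffI)
    fix \<omega> assume "\<omega> \<in> \<theta> t -` B \<inter> space M"
    then show "\<omega> \<in> \<theta> (- t) ` B"
      using flow_inverse[of \<omega> t] by (metis IntD1 IntD2 image_eqI vimageD)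
  next
    fix \<omega> assume "\<omega> \<in> \<theta> (- t) ` B"
    then show "\<omega> \<in> \<theta> t -` B \<inter> space M"
      using sets.sets_into_space[OF assms] flow_inverse[of _ "- t"] flow_in_space by fastforce
  qed
  then show ?thesis
    using flow_preserving assms by simp
qed

lemma cocycle_measurable_at:
  assumes "0 \<le> t"
  shows "\<phi> t x \<in> M \<rightarrow>\<^sub>M borel"
proof -
  have "(\<lambda>\<omega>. (t, x, \<omega>)) \<in> M \<rightarrow>\<^sub>M restrict_space borel {0..} \<Otimes>\<^sub>M (borel \<Otimes>\<^sub>M M)"
    using assms by (intro measurable_Pair measurable_const) (auto simp: space_restrict_space)
  from measurable_compose[OF this cocycle_measurable] show ?thesis
    by simp
qed

lemma coalescence_event_vimage: "\<Gamma> t t\<^sub>0 = \<theta> t\<^sub>0 -` \<Gamma> t 0 \<inter> space M"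
  using flow_in_space flow_zero by (auto simp: coalescence_event_def)

lemma coalescence_event_sets:
  assumes "0 \<le> t"
  shows "\<Gamma> t t\<^sub>0 \<in> events"
proof -
  have "{\<omega> \<in> space M. \<phi> t x (\<theta> t\<^sub>0 \<omega>) = \<phi> t y (\<theta> t\<^sub>0 \<omega>)} \<in> events" for x y
  proof -
    have [measurable]: "(\<lambda>\<omega>. \<phi> t z (\<theta> t\<^sub>0 \<omega>)) \<in> M \<rightarrow>\<^sub>M count_space UNIV" for z
      using measurable_compose[OF flow_measurable_at cocycle_measurable_at[OF assms]]
      by (simp add: measurable_borel_discrete)
    show ?thesis
      by measurable
  qed
  then show ?thesis
    using sets.sets_Collect_finite_All'[of UNIV M
        "\<lambda>x \<omega>. \<forall>y\<in>UNIV. \<phi> t x (\<theta> t\<^sub>0 \<omega>) = \<phi> t y (\<theta> t\<^sub>0 \<omega>)"]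
      sets.sets_Collect_finite_All'[of UNIV M
        "\<lambda>y \<omega>. \<phi> t _ (\<theta> t\<^sub>0 \<omega>) = \<phi> t y (\<theta> t\<^sub>0 \<omega>)"]
    by (simp add: coalescence_event_def)
qed

lemma prob_coalescence_event:
  assumes "0 \<le> t"
  shows "prob (\<Gamma> t t\<^sub>0) = prob (\<Gamma> t 0)"
  using prob_flow_vimage[OF coalescence_event_sets[OF assms]] coalescence_event_vimage by metis

section \<open>Cocycle property in absolute time and monotonicity\<close>

lemma cocycle_add_shifted:
  assumes "0 \<le> s" "0 \<le> t" "\<omega> \<in> space M"
  shows "\<phi> (s + t) x (\<theta> t\<^sub>0 \<omega>) = \<phi> s (\<phi> t x (\<theta> t\<^sub>0 \<omega>)) (\<theta> (t\<^sub>0 + t) \<omega>)"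
  using cocycle_add[OF assms(1,2) flow_in_space[OF assms(3)]] flow_add[OF assms(3), of t t\<^sub>0]
  by (simp add: add.commute)

text \<open>Trajectories that have met stay together. For the second inclusion, coalescence of
  everything started at \<open>t\<^sub>0 + t\<close> covers the states reached there from the
  earlier start.\<close>

lemma coalescence_event_extend:
  assumes "0 \<le> s" "0 \<le> t"
  shows "\<Gamma> t t\<^sub>0 \<subseteq> \<Gamma> (s + t) t\<^sub>0" and "\<Gamma> s (t\<^sub>0 + t) \<subseteq> \<Gamma> (s + t) t\<^sub>0"
  using cocycle_add_shifted[OF assms] unfolding coalescence_event_def by (auto, metis)

lemma coalescence_event_mono: "0 \<le> s \<Longrightarrow> s \<le> t \<Longrightarrow> \<Gamma> s t\<^sub>0 \<subseteq> \<Gamma> t t\<^sub>0"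
  using coalescence_event_extend(1)[of "t - s" s] by simp

lemma coalescence_event_pullback_mono:
  "0 \<le> s \<Longrightarrow> s \<le> t \<Longrightarrow> \<Gamma> s (t\<^sub>0 - s) \<subseteq> \<Gamma> t (t\<^sub>0 - t)"
  using coalescence_event_extend(2)[of s "t - s" "t\<^sub>0 - t"] by simp

lemma prob_coalescence_event_mono: "0 \<le> s \<Longrightarrow> s \<le> t \<Longrightarrow> prob (\<Gamma> s 0) \<le> prob (\<Gamma> t 0)"
  by (intro finite_measure_mono coalescence_event_mono coalescence_event_sets) auto

lemma coalescence_event_iff:
  "\<omega> \<in> space M \<Longrightarrow> \<omega> \<in> \<Gamma> t t\<^sub>0 \<longleftrightarrow> is_singleton (cocycle_image \<phi> t UNIV (\<theta> t\<^sub>0 \<omega>))"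
  by (simp add: coalescence_event_def cocycle_image_def is_singleton_image_UNIV)

section \<open>Equivalent forms of certain coalescence\<close>

text \<open>The hub to which each of (2)--(5) is shown equivalent; by invariance one starting time
  is enough.\<close>

definition coalescence_certain :: bool where
  "coalescence_certain \<longleftrightarrow> ((\<lambda>t. prob (\<Gamma> t 0)) \<longlongrightarrow> 1) at_top"

text \<open>The start \<open>a t\<close> may move with \<open>t\<close>: a constant gives the
  forward statement, \<open>t\<^sub>0 - t\<close> the pullback one. Monotonicity makes natural times
  suffice, which yields measurability and continuity from below.\<close>

lemma increasing_coalescence:
  assumes mono: "\<And>s t. 0 \<le> s \<Longrightarrow> s \<le> t \<Longrightarrow> \<Gamma> s (a s) \<subseteq> \<Gamma> t (a t)"
  defines "E \<equiv> {\<omega> \<in> space M. \<exists>t\<ge>0. is_singleton (cocycle_image \<phi> t UNIV (\<theta> (a t) \<omega>))}"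
  shows "E \<in> events" and "prob E = 1 \<longleftrightarrow> coalescence_certain"
proof -
  have E: "E = (\<Union>n. \<Gamma> (real n) (a (real n)))"
  proof (intro set_eqI iffI)
    fix \<omega> assume "\<omega> \<in> E"
    then obtain t where t: "t \<ge> 0" "\<omega> \<in> \<Gamma> t (a t)"
      by (auto simp: E_def coalescence_event_iff)
    obtain n where "t \<le> real n"
      using real_arch_simple by blast
    then show "\<omega> \<in> (\<Union>n. \<Gamma> (real n) (a (real n)))"
      using mono[of t "real n"] t by blast
  next
    fix \<omega> assume "\<omega> \<in> (\<Union>n. \<Gamma> (real n) (a (real n)))"
    then obtain n where n: "\<omega> \<in> \<Gamma> (real n) (a (real n))"
      by blast
    then have "\<omega> \<in> space M"
      by (simp add: coalescence_event_def)
    with n show "\<omega> \<in> E"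
      by (auto simp: E_def coalescence_event_iff intro!: exI[of _ "real n"])
  qed
  then show "E \<in> events"
    by (auto intro!: coalescence_event_sets)
  have "(\<lambda>n. prob (\<Gamma> (real n) (a (real n)))) \<longlonglongrightarrow> prob E"
    unfolding E
    by (intro finite_Lim_measure_incseq incseq_SucI mono) (auto intro: coalescence_event_sets)
  \<comment> \<open>Invariance removes the moving start from the limit.\<close>
  then have lim: "(\<lambda>n. prob (\<Gamma> (real n) 0)) \<longlonglongrightarrow> prob E"
    by (subst (asm) prob_coalescence_event) auto
  show "prob E = 1 \<longleftrightarrow> coalescence_certain"
  proof
    assume "coalescence_certain"
    then have "(\<lambda>n. prob (\<Gamma> (real n) 0)) \<longlonglongrightarrow> 1"
      unfolding coalescence_certain_def using filterlim_compose filterlim_real_sequentially by blast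
    then show "prob E = 1"
      using lim LIMSEQ_unique by blast
  next
    assume one: "prob E = 1"
    show "coalescence_certain"
      unfolding coalescence_certain_def
    proof (rule order_tendstoI)
      fix b :: real assume "b < 1"
      \<comment> \<open>By monotonicity a lower bound at one natural time persists at all later real
        times.\<close>
      then obtain n where n: "b < prob (\<Gamma> (real n) 0)"
        using order_tendstoD(1)[OF lim, of b] one eventually_sequentially by auto
      show "\<forall>\<^sub>F t in at_top. b < prob (\<Gamma> t 0)"
        using eventually_ge_at_top[of "real n"]
      proof eventually_elim
        case (elim t)
        then show ?case
          using prob_coalescence_event_mono[of "real n" t] n by simp
      qed
    next
      fix b :: real assume "1 < b"
      then show "\<forall>\<^sub>F t in at_top. prob (\<Gamma> t 0) < b"
        by (intro always_eventually) (auto intro: le_less_trans[OF prob_le_1])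
    qed
  qed
qed

lemma coalescence_certain_iff_uniform_limit:
  "coalescence_certain \<longleftrightarrow>
     uniform_limit UNIV (\<lambda>t t\<^sub>0. prob (\<Gamma> t t\<^sub>0)) (\<lambda>_. 1) at_top \<and>
     uniform_limit UNIV (\<lambda>t t\<^sub>0. prob (\<Gamma> t (t\<^sub>0 - t))) (\<lambda>_. 1) at_top"
  unfolding coalescence_certain_def
  by (subst (1 2) uniform_limit_one_iff[where p = "\<lambda>t. prob (\<Gamma> t 0)"])
    (auto intro: prob_coalescence_event)

lemma coalescence_certain_iff_forward:
  "coalescence_certain \<longleftrightarrow> (\<forall>t\<^sub>0. prob {\<omega> \<in> space M.
     \<exists>t\<ge>0. is_singleton (cocycle_image \<phi> t UNIV (\<theta> t\<^sub>0 \<omega>))} = 1)"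
  using increasing_coalescence(2)[of "\<lambda>_. _"] coalescence_event_mono by simp

lemma coalescence_certain_iff_pullback:
  "coalescence_certain \<longleftrightarrow> (\<forall>t\<^sub>0. prob {\<omega> \<in> space M.
     \<exists>t\<ge>0. is_singleton (cocycle_image \<phi> t UNIV (\<theta> (t\<^sub>0 - t) \<omega>))} = 1)"
  using increasing_coalescence(2)[of "\<lambda>t. _ - t"] coalescence_event_pullback_mono by simp

text \<open>An earlier start gives a smaller image at time 0, because the run from
  \<open>- t\<close> passes through some state at time \<open>- s\<close>. The form
  \<open>0 - t\<close> matches the pullback family with \<open>t\<^sub>0 = 0\<close>.\<close>

lemma is_singleton_pullback_attractor:
  assumes "\<omega> \<in> space M"
  shows "is_singleton (pullback_attractor \<theta> \<phi> \<omega>) \<longleftrightarrow>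
    (\<exists>t\<ge>0. is_singleton (cocycle_image \<phi> t UNIV (\<theta> (0 - t) \<omega>)))"
proof -
  have "cocycle_image \<phi> t UNIV (\<theta> (- t) \<omega>) \<subseteq> cocycle_image \<phi> s UNIV (\<theta> (- s) \<omega>)"
    if "0 \<le> s" "s \<le> t" for s t
    using cocycle_add_shifted[of s "t - s" \<omega> _ "- t"] that assms by (auto simp: cocycle_image_def)
  then show ?thesis
    unfolding pullback_attractor_def
    by (subst is_singleton_decreasing_INT) (auto simp: cocycle_image_def)
qed

lemma coalescence_certain_iff_attractor:
  "coalescence_certain \<longleftrightarrow> (AE \<omega> in M. is_singleton (pullback_attractor \<theta> \<phi> \<omega>))"
proof -
  let ?E = "{\<omega> \<in> space M. \<exists>t\<ge>0. is_singleton (cocycle_image \<phi> t UNIV (\<theta> (0 - t) \<omega>))}"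
  note mono = coalescence_event_pullback_mono[where t\<^sub>0 = 0]
  have "(AE \<omega> in M. is_singleton (pullback_attractor \<theta> \<phi> \<omega>)) \<longleftrightarrow> (AE \<omega> in M. \<omega> \<in> ?E)"
    by (intro AE_cong) (simp add: is_singleton_pullback_attractor)
  \<comment> \<open>Reading the almost sure statement as probability one relies on the measurability
    of \<open>?E\<close>.\<close>
  also have "\<dots> \<longleftrightarrow> prob ?E = 1"
    by (rule prob_eq_1[symmetric]) (rule increasing_coalescence(1)[OF mono])
  also have "\<dots> \<longleftrightarrow> coalescence_certain"
    by (rule increasing_coalescence(2)[OF mono])
  finally show ?thesis ..
qed

lemma coalescence_possible:
  assumes coalescence_certain
  shows "\<exists>t>0. prob (\<Gamma> t 0) > 0"
proof -
  have "\<forall>\<^sub>F t in at_top. 0 < prob (\<Gamma> t 0)"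
    using assms unfolding coalescence_certain_def by (rule order_tendstoD) simp
  then have "\<forall>\<^sub>F t in at_top. 0 < t \<and> 0 < prob (\<Gamma> t 0)"
    using eventually_gt_at_top[of "0::real"] by (rule eventually_conj[rotated])
  then show ?thesis
    using eventually_happens'[OF trivial_limit_at_top_linorder] by blast
qed

section \<open>Independence and exponential decay\<close>

text \<open>Independence speaks of preimages of measurable sets of paths. Non-coalescence is one,
  since it involves only the finitely many coordinates at time \<open>a + t\<close>, which lies in
  the observed interval.\<close>

lemma no_coalescence_observed:
  assumes "0 \<le> t" "a + t < b"
  shows "\<exists>D \<in> sets (Pi\<^sub>M ({a..<b} \<times> UNIV) (\<lambda>_. borel)).
    solutions_on \<theta> \<phi> a b -` D \<inter> space M = space M - \<Gamma> t a"
proof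
  let ?P = "Pi\<^sub>M ({a..<b} \<times> (UNIV :: 'x set)) (\<lambda>_. borel :: 'x measure)"
  let ?D = "{f \<in> space ?P. \<exists>x y. f (a + t, x) \<noteq> f (a + t, y)}"
  have [measurable]: "(\<lambda>f. f (a + t, x)) \<in> ?P \<rightarrow>\<^sub>M count_space UNIV" for x
    unfolding measurable_borel_discrete[symmetric]
    using assms by (intro measurable_component_singleton) auto
  show "?D \<in> sets ?P"
    by measurable
  show "solutions_on \<theta> \<phi> a b -` ?D \<inter> space M = space M - \<Gamma> t a"
    using assms
    by (auto simp: solutions_on_def coalescence_event_def space_PiM PiE_def)
qed

text \<open>
  The strict inequality is forced by the half-open observation intervals: coalescence by time \<open>s\<close>
  is visible on \<open>[0, u)\<close> only if \<open>s < u\<close>.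
\<close>
lemma no_coalescence_submultiplicative:
  assumes indep: "indep_on_disjoint_intervals M \<theta> \<phi>" and "0 \<le> s" "s < u" "0 \<le> t"
  shows "1 - prob (\<Gamma> (t + u) 0) \<le> (1 - prob (\<Gamma> s 0)) * (1 - prob (\<Gamma> t 0))"
proof -
  obtain D1 where D1: "D1 \<in> sets (Pi\<^sub>M ({0..<u} \<times> UNIV) (\<lambda>_. borel))"
      "solutions_on \<theta> \<phi> 0 u -` D1 \<inter> space M = space M - \<Gamma> s 0"
    using no_coalescence_observed[of s 0 u] assms by auto
  \<comment> \<open>The extra \<open>1\<close> keeps time \<open>u + t\<close> inside the half-open
    interval; any positive number would do.\<close>
  obtain D2 where D2: "D2 \<in> sets (Pi\<^sub>M ({u..<u + t + 1} \<times> UNIV) (\<lambda>_. borel))"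
      "solutions_on \<theta> \<phi> u (u + t + 1) -` D2 \<inter> space M = space M - \<Gamma> t u"
    using no_coalescence_observed[of t u "u + t + 1"] assms by auto
  have "indep_var
      (Pi\<^sub>M ({0..<u} \<times> UNIV) (\<lambda>_. borel)) (solutions_on \<theta> \<phi> 0 u)
      (Pi\<^sub>M ({u..<u + t + 1} \<times> UNIV) (\<lambda>_. borel)) (solutions_on \<theta> \<phi> u (u + t + 1))"
    using indep unfolding indep_on_disjoint_intervals_def by auto
  from indep_varD[OF this D1(1) D2(1)]
  have "prob ((\<lambda>\<omega>. (solutions_on \<theta> \<phi> 0 u \<omega>, solutions_on \<theta> \<phi> u (u + t + 1) \<omega>)) -` (D1 \<times> D2)
        \<inter> space M) =
      prob (solutions_on \<theta> \<phi> 0 u -` D1 \<inter> space M) *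
      prob (solutions_on \<theta> \<phi> u (u + t + 1) -` D2 \<inter> space M)"
    .
  also have "(\<lambda>\<omega>. (solutions_on \<theta> \<phi> 0 u \<omega>, solutions_on \<theta> \<phi> u (u + t + 1) \<omega>)) -` (D1 \<times> D2)
        \<inter> space M = (space M - \<Gamma> s 0) \<inter> (space M - \<Gamma> t u)"
    using D1(2) D2(2) by auto
  finally have "prob ((space M - \<Gamma> s 0) \<inter> (space M - \<Gamma> t u)) =
      prob (space M - \<Gamma> s 0) * prob (space M - \<Gamma> t u)"
    using D1(2) D2(2) by simp
  \<comment> \<open>By contraposition: coalescence by time \<open>s\<close>, or on
    \<open>[u, u + t]\<close> from all states at \<open>u\<close>, entails coalescence by time
    \<open>t + u\<close>.\<close>
  moreover have "prob (space M - \<Gamma> (t + u) 0) \<le> prob ((space M - \<Gamma> s 0) \<inter> (space M - \<Gamma> t u))"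
    using coalescence_event_mono[of s "t + u" 0] coalescence_event_extend(2)[of t u 0] assms
    by (intro finite_measure_mono) (auto intro!: sets.Int sets.compl_sets coalescence_event_sets)
  ultimately show ?thesis
    using assms by (simp add: prob_compl coalescence_event_sets prob_coalescence_event[of t u])
qed

lemma no_coalescence_exponential:
  assumes indep: "indep_on_disjoint_intervals M \<theta> \<phi>" and "\<exists>t>0. prob (\<Gamma> t 0) > 0"
  shows "\<exists>C>0. \<exists>c>0. \<forall>t\<ge>0. 1 - prob (\<Gamma> t 0) \<le> C * exp (- c * t)"
proof -
  obtain T where T: "T > 0" "prob (\<Gamma> T 0) > 0"
    using assms by blast
  define r where "r = 1 - prob (\<Gamma> T 0)"
  have r: "0 \<le> r" "r < 1"
    using T by (auto simp: r_def)
  \<comment> \<open>Windows of length \<open>T\<close> recur with period \<open>2 * T\<close>, and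
    the idle time \<open>T\<close> between them supplies the strict inequality. The induction step
    takes \<open>s = real n * (2 * T) + T\<close> and
    \<open>u = real (Suc n) * (2 * T)\<close>.\<close>
  have shifted: "1 - prob (\<Gamma> (real n * (2 * T) + T) 0) \<le> r ^ Suc n" for n
  proof (induction n)
    case 0
    show ?case by (simp add: r_def)
  next
    case (Suc n)
    have "1 - prob (\<Gamma> (T + real (Suc n) * (2 * T)) 0) \<le>
        (1 - prob (\<Gamma> (real n * (2 * T) + T) 0)) * r"
      unfolding r_def using T
      by (intro no_coalescence_submultiplicative indep) (auto simp: algebra_simps)
    also have "\<dots> \<le> r ^ Suc n * r"
      using Suc r by (intro mult_right_mono)
    finally show ?case
      by (simp add: algebra_simps)
  qed
  have "1 - prob (\<Gamma> (real n * (2 * T)) 0) \<le> r ^ n" for n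
  \<comment> \<open>For \<open>n = 0\<close> the bound is \<open>1\<close>; for
    \<open>n = Suc m\<close> the required power is already reached one idle time earlier.\<close>
  proof (cases n)
    case (Suc m)
    have "prob (\<Gamma> (real m * (2 * T) + T) 0) \<le> prob (\<Gamma> (real n * (2 * T)) 0)"
      using T Suc by (intro prob_coalescence_event_mono) (auto simp: algebra_simps)
    then show ?thesis
      using shifted[of m] Suc by simp
  qed simp
  then show ?thesis
    using T r prob_coalescence_event_mono
    by (intro exp_bound_of_power_bound[of "2 * T" r]) auto
qed

text \<open>Together with the decay estimate this leads from (1) back to (2)--(5).\<close>

lemma coalescence_certain_of_exponential:
  assumes "0 < c" "\<And>t. 0 \<le> t \<Longrightarrow> 1 - prob (\<Gamma> t 0) \<le> C * exp (- c * t)"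
  shows coalescence_certain
  unfolding coalescence_certain_def
proof (rule tendsto_sandwich)
  show "\<forall>\<^sub>F t in at_top. 1 - C * exp (- c * t) \<le> prob (\<Gamma> t 0)"
    using eventually_ge_at_top[of 0] by eventually_elim (use assms(2) in \<open>simp add: algebra_simps\<close>)
  show "\<forall>\<^sub>F t in at_top. prob (\<Gamma> t 0) \<le> 1"
    by simp
  show "((\<lambda>t. 1 - C * exp (- c * t)) \<longlongrightarrow> 1) at_top"
    using \<open>0 < c\<close> by real_asymp
qed simp

end

theorem theorem8:
  fixes M :: "'w measure"
    and \<theta> :: "real \<Rightarrow> 'w \<Rightarrow> 'w"
    and \<phi> :: "real \<Rightarrow> 'x::{finite, discrete_topology} \<Rightarrow> 'w \<Rightarrow> 'x"
  assumes "continuous_rds M \<theta> \<phi>"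
  shows
    "let \<Gamma> = coalescence_event M \<theta> \<phi>;
         S1 = (\<exists>t>0. measure M (\<Gamma> t 0) > 0);
         S2 = (uniform_limit UNIV (\<lambda>t t\<^sub>0. measure M (\<Gamma> t t\<^sub>0)) (\<lambda>_. 1) at_top \<and>
               uniform_limit UNIV (\<lambda>t t\<^sub>0. measure M (\<Gamma> t (t\<^sub>0 - t))) (\<lambda>_. 1) at_top);
         S3 = (\<forall>t\<^sub>0. measure M {\<omega> \<in> space M.
                 \<exists>t\<ge>0. is_singleton (cocycle_image \<phi> t UNIV (\<theta> t\<^sub>0 \<omega>))} = 1);
         S4 = (\<forall>t\<^sub>0. measure M {\<omega> \<in> space M.
                 \<exists>t\<ge>0. is_singleton (cocycle_image \<phi> t UNIV (\<theta> (t\<^sub>0 - t) \<omega>))} = 1);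
         S5 = (AE \<omega> in M. is_singleton (pullback_attractor \<theta> \<phi> \<omega>))
     in (S2 \<longleftrightarrow> S3) \<and> (S2 \<longleftrightarrow> S4) \<and> (S2 \<longleftrightarrow> S5) \<and> (S2 \<longrightarrow> S1) \<and>
        (indep_on_disjoint_intervals M \<theta> \<phi> \<longrightarrow>
           (S1 \<longleftrightarrow> S2) \<and>
           (S2 \<longrightarrow> (\<exists>C>0. \<exists>c>0. \<forall>t\<ge>0. \<forall>t\<^sub>0.
              1 - measure M (\<Gamma> t t\<^sub>0) \<le> C * exp (- c * t) \<and>
              1 - measure M (\<Gamma> t (t\<^sub>0 - t)) \<le> C * exp (- c * t))))"
proof -
  interpret finite_rds M \<theta> \<phi>
    using assms by (simp add: finite_rds_def)
  \<comment> \<open>Invariance carries the bound from start time \<open>0\<close> to all start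
    times, including \<open>t\<^sub>0 - t\<close>, with the same constants.\<close>
  have exponential: "\<exists>C>0. \<exists>c>0. \<forall>t\<ge>0. \<forall>t\<^sub>0.
      1 - prob (\<Gamma> t t\<^sub>0) \<le> C * exp (- c * t) \<and>
      1 - prob (\<Gamma> t (t\<^sub>0 - t)) \<le> C * exp (- c * t)"
    if "indep_on_disjoint_intervals M \<theta> \<phi>" "\<exists>t>0. prob (\<Gamma> t 0) > 0"
    using no_coalescence_exponential[OF that] prob_coalescence_event by metis
  have "coalescence_certain" if "indep_on_disjoint_intervals M \<theta> \<phi>" "\<exists>t>0. prob (\<Gamma> t 0) > 0"
    using no_coalescence_exponential[OF that] coalescence_certain_of_exponential by blast
  \<comment> \<open>Once (2)--(5) are folded into \<open>coalescence_certain\<close>, only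
    implications with (1) and the decay bound remain.\<close>
  then show ?thesis
    unfolding Let_def coalescence_certain_iff_uniform_limit[symmetric]
      coalescence_certain_iff_forward[symmetric] coalescence_certain_iff_pullback[symmetric]
      coalescence_certain_iff_attractor[symmetric]
    using coalescence_possible exponential by blast
qed

end
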